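(* Let $\lambda$ be a partition, $\pi$ a reverse plane partition of shape $\lambda$ and $u\in\mathrm{cand}(\pi)$ a candidate. Then there exists a factor $h\in\mathcal F(\pi)$ with $h\le h(u,\pi)$.
   Context: Cells are pairs $(i,j)\in\mathbb Z^2$; $\mathrm n(i,j)=(i-1,j)$, $\mathrm e(i,j)=(i,j+1)$, $\mathrm s(i,j)=(i+1,j)$, $\mathrm w(i,j)=(i,j-1)$. A partition $\lambda$ is identified with its Young diagram; $\lambda'$ is its conjugate. A reverse plane partition of shape $\lambda$ is $\pi:\lambda\to\mathbb N$ with $\pi(u)\le\pi(\mathrm e u),\pi(\mathrm s u)$, with conventions $\pi(i,j)=0$ if $i\le0$ or $j\le0$, $\pi(i,j)=\infty$ if $i,j\ge1$, $(i,j)\notin\lambda$. Content $c(i,j)=j-i$; outer corner: $u\in\lambda$, $\mathrm e u,\mathrm s u\notin\lambda$; inner corner: $\mathrm e u,\mathrm s u\in\lambda$, $\mathrm e\mathrm s u\notin\lambda$. With inner corner contents $i_1<\dots<i_r$ and outer corner contents $o_1<\dots<o_{r+1}$ (interlacing), $\mathcal I=\{u\in\lambda:c(u)=i_k\}$, $\mathcal O=\{u\in\lambda:c(u)=o_k\}$, $\mathcal A=\{u\in\lambda:c(u)<o_1\text{ or }i_k<c(u)<o_{k+1}\text{ for some }k\in[r]\}$, $\mathcal B=\{u\in\lambda:o_k<c(u)<i_k\text{ for some }k\in[r]\text{ or }c(u)>o_{r+1}\}$. Candidates: $\mathrm{cand}(\pi)=\{u\in\mathcal O:\pi(u)>\pi(\mathrm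 w u)\}\cup\{u\in\mathcal A:\pi(u)>\pi(\mathrm w u),\pi(u)>\pi(\mathrm n u)\}$. North-east path: $(u_0,\dots,u_s)$ in $\lambda$, $u_k\in\{\mathrm n u_{k-1},\mathrm e u_{k-1}\}$, length $s$, head $\alpha=u_0$, tail $\omega=u_s$. South-west path: $(v_0,\dots,v_s)$, $v_k\in\{\mathrm s v_{k-1},\mathrm w v_{k-1}\}$, length $s$, $\alpha=v_s$, $\omega=v_0$. Rim-hook: north-east path $h$ with $\mathrm s\alpha(h)\notin\lambda$, $\mathrm e\omega(h)\notin\lambda$, $\mathrm e\mathrm s u\notin\lambda$ for all $u\in h$; for $u=(i,j)\in\lambda$, $h^u$ is the rim-hook from $(\lambda'_j,j)$ to $(i,\lambda_i)$, and these are all rim-hooks. Reverse lexicographic order on cells: $(i,j)\le(k,l)$ iff $j>l$, or $j=l$ and $i\ge k$; rim-hooks are ordered by $h^u\le h^v$ iff $u\le v$. $(\pi-P)(u)=\pi(u)-1$ for $u\in P$, else $\pi(u)$. $(P,\pi)$ compatible: $u\in P\cap(\mathcal I\cup\mathcal A)$ implies $\mathrm e u\in P$ and $\pi(u)=\pi(\mathrm e u)$; $u,\mathrm s u\in P$ implies $\pi(u)=\pi(\mathrm s u)$. $h\in\mathcal F(\pi)$ (factor) if there is a south-west path $P$ with $\omega(P)=\omega(h)$, $\ell(P)=\ell(h)$, $(P,\pi)$ compatible and $\pi-P$ a reverse plane partition. For $v\in\mathrm{cand}(\pi)$, $Q(v,\pi)$ is the north-east path starting at $v$ which, from current cell $u$,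 moves to $\mathrm n u$ if $u\in\mathcal O\cup\mathcal B$ and $\pi(u)=\pi(\mathrm n u)$; to $\mathrm e u$ if $u\in\mathcal I\cup\mathcal A$, or if $\mathrm e u\in\lambda$ and $\pi(u)>\pi(\mathrm n u)$; and terminates if $\pi(u)>\pi(\mathrm n u)$ and $\mathrm e u\notin\lambda$. $h(v,\pi)$ is the rim-hook of $\lambda$ with $\omega(h(v,\pi))=\omega(Q(v,\pi))$ and $\ell(h(v,\pi))=\ell(Q(v,\pi))$. *)

theory Defs
  imports Main "HOL-Library.Extended"
begin

type_synonym cell = "int \<times> int"

text \<open>Matrix coordinates: rows grow downwards, columns grow to the right.\<close>

definition north :: "cell \<Rightarrow> cell" where "north u = (fst u - 1, snd u)"
definition east  :: "cell \<Rightarrow> cell" where "east u = (fst u, snd u + 1)"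
definition south :: "cell \<Rightarrow> cell" where "south u = (fst u + 1, snd u)"
definition west  :: "cell \<Rightarrow> cell" where "west u = (fst u, snd u - 1)"

definition content :: "cell \<Rightarrow> int" where
  "content u = snd u - fst u"

definition is_partition :: "nat list \<Rightarrow> bool" where
  "is_partition lam \<longleftrightarrow> sorted_wrt (\<ge>) lam \<and> 0 \<notin> set lam"

text \<open>Lists are indexed from 0, parts of a partition from 1.\<close>

definition part :: "nat list \<Rightarrow> int \<Rightarrow> int" where
  "part lam i = int (lam ! nat (i - 1))"

definition conjugate :: "nat list \<Rightarrow> nat list" where
  "conjugate lam =
     map (\<lambda>j. length (filter (\<lambda>p. j < p) lam)) [0..<(if lam = [] then 0 else hd lam)]"

definition diagram :: "nat list \<Rightarrow> cell set" where
  "diagram lam = {(i, j). 1 \<le> i \<and> i \<le> int (length lam) \<and> 1 \<le> j \<and> j \<le> part lam i}"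

text \<open>
  Fillings are integer-valued, so that subtracting 1 along a path is not truncated at 0;
  nonnegativity is part of being a reverse plane partition.  A filling is a total function,
  but its values outside the diagram are never used: comparisons go through \<open>val\<close>, which
  replaces them by the boundary conventions 0 and infinity.
\<close>

definition val :: "nat list \<Rightarrow> (cell \<Rightarrow> int) \<Rightarrow> cell \<Rightarrow> int extended" where
  "val lam \<pi> u =
     (if fst u \<le> 0 \<or> snd u \<le> 0 then 0
      else if u \<in> diagram lam then Fin (\<pi> u)
      else Pinf)"

definition is_rpp :: "nat list \<Rightarrow> (cell \<Rightarrow> int) \<Rightarrow> bool" where
  "is_rpp lam \<pi> \<longleftrightarrow>
     (\<forall>u\<in>diagram lam. 0 \<le> \<pi> u
        \<and> val lam \<pi> u \<le> val lam \<pi> (east u)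
        \<and> val lam \<pi> u \<le> val lam \<pi> (south u))"

definition outer_corners :: "nat list \<Rightarrow> cell set" where
  "outer_corners lam =
     {u \<in> diagram lam. east u \<notin> diagram lam \<and> south u \<notin> diagram lam}"

definition inner_corners :: "nat list \<Rightarrow> cell set" where
  "inner_corners lam =
     {u. east u \<in> diagram lam \<and> south u \<in> diagram lam \<and> east (south u) \<notin> diagram lam}"

text \<open>
  The increasing lists \<open>i\<^sub>1 < \<dots> < i\<^sub>r\<close> and \<open>o\<^sub>1 < \<dots> < o\<^sub>r\<^sub>+\<^sub>1\<close>, indexed from 0:
  \<open>i\<^sub>k\<close> is \<open>inner_contents lam ! (k - 1)\<close>, and likewise for \<open>o\<^sub>k\<close>.
\<close>

definition inner_contents :: "nat list \<Rightarrow> int list" where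
  "inner_contents lam = sorted_list_of_set (content ` inner_corners lam)"

definition outer_contents :: "nat list \<Rightarrow> int list" where
  "outer_contents lam = sorted_list_of_set (content ` outer_corners lam)"

definition I_cells :: "nat list \<Rightarrow> cell set" where
  "I_cells lam = {u \<in> diagram lam. content u \<in> set (inner_contents lam)}"

definition O_cells :: "nat list \<Rightarrow> cell set" where
  "O_cells lam = {u \<in> diagram lam. content u \<in> set (outer_contents lam)}"

definition A_cells :: "nat list \<Rightarrow> cell set" where
  "A_cells lam = {u \<in> diagram lam.
     content u < outer_contents lam ! 0 \<or>
     (\<exists>k < length (inner_contents lam).
        inner_contents lam ! k < content u \<and> content u < outer_contents lam ! (k + 1))}"

definition B_cells :: "nat list \<Rightarrow> cell set" where
  "B_cells lam = {u \<in> diagram lam.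
     (\<exists>k < length (inner_contents lam).
        outer_contents lam ! k < content u \<and> content u < inner_contents lam ! k) \<or>
     content u > outer_contents lam ! length (inner_contents lam)}"

definition cand :: "nat list \<Rightarrow> (cell \<Rightarrow> int) \<Rightarrow> cell set" where
  "cand lam \<pi> =
     {u \<in> O_cells lam. val lam \<pi> u > val lam \<pi> (west u)} \<union>
     {u \<in> A_cells lam. val lam \<pi> u > val lam \<pi> (west u) \<and> val lam \<pi> u > val lam \<pi> (north u)}"

text \<open>
  Paths are the lists of their cells in the order in which they are traversed.  The head
  \<open>\<alpha>\<close> is always the south-west end and the tail \<open>\<omega>\<close> the north-east end, hence \<open>hd\<close> and
  \<open>last\<close> for a north-east path, but \<open>last\<close> and \<open>hd\<close> for a south-west path.
\<close>

definition ne_path :: "nat list \<Rightarrow> cell list \<Rightarrow> bool" where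
  "ne_path lam p \<longleftrightarrow> p \<noteq> [] \<and> set p \<subseteq> diagram lam
     \<and> successively (\<lambda>u u'. u' = north u \<or> u' = east u) p"

definition sw_path :: "nat list \<Rightarrow> cell list \<Rightarrow> bool" where
  "sw_path lam p \<longleftrightarrow> p \<noteq> [] \<and> set p \<subseteq> diagram lam
     \<and> successively (\<lambda>v v'. v' = south v \<or> v' = west v) p"

definition path_length :: "cell list \<Rightarrow> nat" where
  "path_length p = length p - 1"

definition ne_head :: "cell list \<Rightarrow> cell" where "ne_head p = hd p"
definition ne_tail :: "cell list \<Rightarrow> cell" where "ne_tail p = last p"
definition sw_head :: "cell list \<Rightarrow> cell" where "sw_head p = last p"
definition sw_tail :: "cell list \<Rightarrow> cell" where "sw_tail p = hd p"

definition rim_hook :: "nat list \<Rightarrow> cell list \<Rightarrow> bool" where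
  "rim_hook lam h \<longleftrightarrow> ne_path lam h
     \<and> south (ne_head h) \<notin> diagram lam
     \<and> east (ne_tail h) \<notin> diagram lam
     \<and> (\<forall>u\<in>set h. east (south u) \<notin> diagram lam)"

text \<open>\<open>rim_hook_at lam u h\<close> says that \<open>h\<close> is the rim-hook \<open>h\<^sup>u\<close>.\<close>

definition rim_hook_at :: "nat list \<Rightarrow> cell \<Rightarrow> cell list \<Rightarrow> bool" where
  "rim_hook_at lam u h \<longleftrightarrow> u \<in> diagram lam \<and> rim_hook lam h
     \<and> ne_head h = (part (conjugate lam) (snd u), snd u)
     \<and> ne_tail h = (fst u, part lam (fst u))"

definition revlex_le :: "cell \<Rightarrow> cell \<Rightarrow> bool" where
  "revlex_le u v \<longleftrightarrow> snd u > snd v \<or> snd u = snd v \<and> fst u \<ge> fst v"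

definition rim_hook_le :: "nat list \<Rightarrow> cell list \<Rightarrow> cell list \<Rightarrow> bool" where
  "rim_hook_le lam h h' \<longleftrightarrow>
     (\<exists>u v. rim_hook_at lam u h \<and> rim_hook_at lam v h' \<and> revlex_le u v)"

definition minus_path :: "(cell \<Rightarrow> int) \<Rightarrow> cell list \<Rightarrow> cell \<Rightarrow> int" where
  "minus_path \<pi> P u = (if u \<in> set P then \<pi> u - 1 else \<pi> u)"

definition compatible :: "nat list \<Rightarrow> cell list \<Rightarrow> (cell \<Rightarrow> int) \<Rightarrow> bool" where
  "compatible lam P \<pi> \<longleftrightarrow>
     (\<forall>u. u \<in> set P \<inter> (I_cells lam \<union> A_cells lam) \<longrightarrow>
          east u \<in> set P \<and> val lam \<pi> u = val lam \<pi> (east u)) \<and>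
     (\<forall>u. u \<in> set P \<and> south u \<in> set P \<longrightarrow> val lam \<pi> u = val lam \<pi> (south u))"

definition factors :: "nat list \<Rightarrow> (cell \<Rightarrow> int) \<Rightarrow> cell list set" where
  "factors lam \<pi> = {h. rim_hook lam h \<and>
     (\<exists>P. sw_path lam P \<and> sw_tail P = ne_tail h \<and> path_length P = path_length h
        \<and> compatible lam P \<pi> \<and> is_rpp lam (minus_path \<pi> P))}"

definition Q_step :: "nat list \<Rightarrow> (cell \<Rightarrow> int) \<Rightarrow> cell \<Rightarrow> cell \<Rightarrow> bool" where
  "Q_step lam \<pi> u u' \<longleftrightarrow>
     u \<in> O_cells lam \<union> B_cells lam \<and> val lam \<pi> u = val lam \<pi> (north u) \<and> u' = north u \<or>
     (u \<in> I_cells lam \<union> A_cells lam \<or>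
        east u \<in> diagram lam \<and> val lam \<pi> u > val lam \<pi> (north u)) \<and> u' = east u"

definition Q_stop :: "nat list \<Rightarrow> (cell \<Rightarrow> int) \<Rightarrow> cell \<Rightarrow> bool" where
  "Q_stop lam \<pi> u \<longleftrightarrow> val lam \<pi> u > val lam \<pi> (north u) \<and> east u \<notin> diagram lam"

text \<open>
  If \<open>\<pi>\<close> is a reverse plane partition and \<open>v\<close> a candidate, exactly one path and exactly
  one rim-hook satisfy the following two descriptions.
\<close>

definition Q_path :: "nat list \<Rightarrow> cell \<Rightarrow> (cell \<Rightarrow> int) \<Rightarrow> cell list" where
  "Q_path lam v \<pi> = (THE q. ne_path lam q \<and> ne_head q = v
     \<and> successively (Q_step lam \<pi>) q \<and> Q_stop lam \<pi> (ne_tail q))"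

definition cand_hook :: "nat list \<Rightarrow> cell \<Rightarrow> (cell \<Rightarrow> int) \<Rightarrow> cell list" where
  "cand_hook lam v \<pi> = (THE h. rim_hook lam h
     \<and> ne_tail h = ne_tail (Q_path lam v \<pi>)
     \<and> path_length h = path_length (Q_path lam v \<pi>))"

end

theory Submission
  imports Defs
begin

text \<open>
  If no candidate has content greater than \<open>c\<close>, then \<open>\<pi>(u) = \<pi>(w u)\<close> for all cells \<open>u\<close> of
  \<open>\<O> \<union> \<A>\<close> of content greater than \<open>c\<close>: otherwise walking north from \<open>u\<close> through equal
  values meets a candidate.  Hence, for a candidate \<open>v\<close> of maximal content, the path
  \<open>Q(v, \<pi>)\<close> traversed backwards is compatible and can be subtracted, so that \<open>h(v, \<pi>)\<close>
  is a factor; the invariant along \<open>Q(v, \<pi>)\<close> is \<open>\<pi>(n w u) < \<pi>(u)\<close>.  A hook whose head has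
  greater content starts further to the right, so \<open>h(v, \<pi>)\<close> precedes the hooks of all
  candidates of smaller content.
\<close>

section \<open>Counting in sorted lists of integers\<close>

text \<open>The indices of entries below \<open>c\<close> form an initial segment of the increasing
  list, one index per element below \<open>c\<close>. Conditions on indexed corner contents thereby
  become counting inequalities.\<close>

lemma sorted_list_nth_less_iff:
  fixes X :: "int set"
  assumes "finite X" "k < card X"
  shows "sorted_list_of_set X ! k < c \<longleftrightarrow> k < card {x \<in> X. x < c}"
proof -
  let ?xs = "sorted_list_of_set X"
  let ?J = "{i. i < card X \<and> ?xs ! i < c}"
  have len: "length ?xs = card X" by simp
  have srt: "sorted_wrt (<) ?xs" by simp
  have "{x \<in> X. x < c} = nth ?xs ` ?J"
  proof -
    have "X = nth ?xs ` {..<card X}"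
      using assms(1) nth_image[of "length ?xs" ?xs] by (simp add: atLeast0LessThan)
    then show ?thesis by auto
  qed
  moreover have "inj_on (nth ?xs) ?J"
    by (auto simp: inj_on_def nth_eq_iff_index_eq)
  ultimately have card: "card {x \<in> X. x < c} = card ?J" by (simp add: card_image)
  have fin: "finite ?J" by simp
  show ?thesis
  proof (cases "?xs ! k < c")
    case True
    have "{..k} \<subseteq> ?J"
    proof
      fix i assume "i \<in> {..k}"
      then have "i < card X" "?xs ! i \<le> ?xs ! k"
        using assms(2) sorted_nth_mono[of ?xs i k] by auto
      then show "i \<in> ?J" using True by auto
    qed
    from card_mono[OF fin this] True card show ?thesis by simp
  next
    case False
    have "?J \<subseteq> {..<k}"
    proof
      fix i assume i: "i \<in> ?J"
      show "i \<in> {..<k}"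
      proof (rule ccontr)
        assume "i \<notin> {..<k}"
        then have "?xs ! k \<le> ?xs ! i" using i sorted_nth_mono[of ?xs k i] by auto
        then show False using i False by auto
      qed
    qed
    from card_mono[OF _ this] False card show ?thesis by simp
  qed
qed

lemma less_sorted_list_nth_iff:
  fixes X :: "int set"
  assumes "finite X" "k < card X"
  shows "c < sorted_list_of_set X ! k \<longleftrightarrow> card {x \<in> X. x < c + 1} \<le> k"
  using sorted_list_nth_less_iff[OF assms, of "c + 1"] by linarith

lemma card_less_Suc:
  fixes X :: "int set"
  assumes "finite X"
  shows "card {x \<in> X. x < c + 1} = card {x \<in> X. x < c} + of_bool (c \<in> X)"
proof -
  have "{x \<in> X. x < c + 1} = {x \<in> X. x < c} \<union> (if c \<in> X then {c} else {})"
    by (auto simp: order_less_le)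
  then show ?thesis using assms by (simp add: card_Un_disjoint)
qed

section \<open>Contents along paths\<close>

lemmas cell_simps = north_def east_def south_def west_def content_def

lemma content_step [simp]:
  "content (north u) = content u + 1" "content (east u) = content u + 1"
  "content (south u) = content u - 1" "content (west u) = content u - 1"
  by (auto simp: cell_simps)

lemma step_inverse [simp]:
  "north (south u) = u" "south (north u) = u" "east (west u) = u" "west (east u) = u"
  by (auto simp: cell_simps)

text \<open>Both admissible steps raise the content by one, so position and content on a north-east
  path determine each other.\<close>

lemma ne_path_content_nth:
  assumes "ne_path lam q" "k < length q"
  shows "content (q ! k) = content (hd q) + int k"
  using assms(2)
proof (induction k)
  case 0
  then show ?case by (simp add: hd_conv_nth)
next
  case (Suc k)
  then have "q ! Suc k = north (q ! k) \<or> q ! Suc k = east (q ! k)"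
    using assms(1) by (auto simp: ne_path_def successively_conv_nth)
  then show ?case using Suc by auto
qed

lemma ne_path_content_last:
  assumes "ne_path lam q"
  shows "content (last q) = content (hd q) + int (path_length q)"
  using ne_path_content_nth[OF assms, of "length q - 1"] assms
  by (cases q) (auto simp: ne_path_def path_length_def last_conv_nth)

section \<open>The rim of a Young diagram\<close>

locale young_diagram =
  fixes lam :: "nat list"
  assumes is_partition: "is_partition lam"
begin

abbreviation D :: "cell set" where "D \<equiv> diagram lam"

lemma D_pos: "x \<in> D \<Longrightarrow> 1 \<le> fst x \<and> 1 \<le> snd x"
  by (auto simp: diagram_def)

lemma finite_D: "finite D"
proof -
  have "D = (SIGMA i : {1..int (length lam)}. {1..part lam i})" by (auto simp: diagram_def)
  then show ?thesis by simp
qed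

text \<open>Row lengths weakly decrease. The contradiction arguments about the rim rest on this
  closure towards the north-west.\<close>

lemma D_ideal:
  assumes "x \<in> D" "1 \<le> fst y" "fst y \<le> fst x" "1 \<le> snd y" "snd y \<le> snd x"
  shows "y \<in> D"
proof -
  obtain i j where y: "y = (i, j)" by force
  obtain k l where x: "x = (k, l)" by force
  have "sorted_wrt (\<ge>) lam" using is_partition by (simp add: is_partition_def)
  moreover have "nat (i - 1) \<le> nat (k - 1)" "nat (k - 1) < length lam"
    using assms x y by (auto simp: diagram_def)
  ultimately have "lam ! nat (i - 1) \<ge> lam ! nat (k - 1)"
    by (metis order.refl order_le_less sorted_wrt_nth_less)
  then show ?thesis using assms x y by (auto simp: diagram_def part_def)
qed

lemma row_end:
  assumes "x \<in> D" "east x \<notin> D"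
  shows "part lam (fst x) = snd x"
  using assms by (auto simp: diagram_def east_def)

text \<open>The conjugate part counts the rows of length at least the column of \<open>x\<close>; by
  \<open>D_ideal\<close> and the missing south neighbour these are the rows up to that of
  \<open>x\<close>. List index \<open>k\<close> stands for row \<open>k + 1\<close>.\<close>

lemma column_end:
  assumes "x \<in> D" "south x \<notin> D"
  shows "part (conjugate lam) (snd x) = fst x"
proof -
  obtain i j where x: "x = (i, j)" by force
  have ij: "1 \<le> i" "1 \<le> j" "i \<le> int (length lam)" "j \<le> part lam i"
    using assms(1) x by (auto simp: diagram_def)
  have lam: "lam \<noteq> []" using ij by auto
  have "(1, j) \<in> D" using D_ideal[OF assms(1), of "(1, j)"] ij x by simp
  then have "nat (j - 1) < hd lam"
    using lam ij by (auto simp: diagram_def part_def hd_conv_nth)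
  then have "part (conjugate lam) j = int (length (filter (\<lambda>p. nat (j - 1) < p) lam))"
    using lam by (simp add: part_def conjugate_def)
  also have "length (filter (\<lambda>p. nat (j - 1) < p) lam)
      = card {k. k < length lam \<and> nat (j - 1) < lam ! k}"
    by (simp add: length_filter_conv_card)
  also have "{k. k < length lam \<and> nat (j - 1) < lam ! k} = {..<nat i}"
  proof (intro set_eqI iffI)
    fix k assume k: "k \<in> {k. k < length lam \<and> nat (j - 1) < lam ! k}"
    show "k \<in> {..<nat i}"
    proof (rule ccontr)
      assume "k \<notin> {..<nat i}"
      moreover have "(int k + 1, j) \<in> D" using k ij by (auto simp: diagram_def part_def)
      ultimately have "(i + 1, j) \<in> D" using D_ideal[of "(int k + 1, j)" "(i + 1, j)"] ij by auto
      then show False using assms(2) x by (simp add: south_def)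
    qed
  next
    fix k assume k: "k \<in> {..<nat i}"
    then have "(int k + 1, j) \<in> D" using D_ideal[OF assms(1), of "(int k + 1, j)"] ij x by auto
    then show "k \<in> {k. k < length lam \<and> nat (j - 1) < lam ! k}"
      by (auto simp: diagram_def part_def)
  qed
  finally show ?thesis using ij x by simp
qed

section \<open>Rim cells and types of diagonals\<close>

abbreviation contents :: "int set" where "contents \<equiv> content ` D"

text \<open>The south-easternmost diagram cell on the diagonal of content \<open>c\<close>;
  unspecified if that diagonal misses the diagram.\<close>

definition rim :: "int \<Rightarrow> cell" where
  "rim c = (THE r. r \<in> D \<and> content r = c \<and> east (south r) \<notin> D)"

lemma finite_contents: "finite contents"
  using finite_D by simp

text \<open>Of two distinct cells on a diagonal, the upper one has its south-east neighbour weakly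
  north-west of the lower one, hence in the diagram.\<close>

lemma rim_unique:
  assumes "r \<in> D" "r' \<in> D" "content r = content r'"
    "east (south r) \<notin> D" "east (south r') \<notin> D"
  shows "r = r'"
proof (rule ccontr)
  assume "r \<noteq> r'"
  then have "fst r \<noteq> fst r'" using assms(3) by (auto simp: content_def prod_eq_iff)
  then consider "fst r < fst r'" | "fst r' < fst r" by linarith
  then show False
  proof cases
    case 1
    then show False
      using D_ideal[OF assms(2), of "east (south r)"] D_pos[OF assms(1)] assms by (auto simp: cell_simps)
  next
    case 2
    then show False
      using D_ideal[OF assms(1), of "east (south r')"] D_pos[OF assms(2)] assms by (auto simp: cell_simps)
  qed
qed

lemma rim_exists:
  assumes "c \<in> contents"
  shows "\<exists>r. r \<in> D \<and> content r = c \<and> east (south r) \<notin> D"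
proof -
  let ?X = "{x \<in> D. content x = c}"
  have "finite (fst ` ?X)" "fst ` ?X \<noteq> {}" using assms finite_D by auto
  from Max_in[OF this] obtain r where r: "r \<in> ?X" "fst r = Max (fst ` ?X)" by auto
  have "east (south r) \<notin> D"
  proof
    assume "east (south r) \<in> D"
    then have "fst (east (south r)) \<in> fst ` ?X" using r(1) by auto
    then have "fst (east (south r)) \<le> fst r" unfolding r(2) using finite_D by (intro Max_ge) auto
    then show False by (simp add: cell_simps)
  qed
  then show ?thesis using r(1) by blast
qed

lemma rim:
  assumes "c \<in> contents"
  shows rim_in_D: "rim c \<in> D" and content_rim: "content (rim c) = c"
    and east_south_rim: "east (south (rim c)) \<notin> D"
proof -
  have "\<exists>!r. r \<in> D \<and> content r = c \<and> east (south r) \<notin> D"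
    using rim_exists[OF assms] rim_unique by blast
  from theI'[OF this] show "rim c \<in> D" "content (rim c) = c" "east (south (rim c)) \<notin> D"
    by (auto simp: rim_def)
qed

lemma rim_eqI:
  assumes "r \<in> D" "east (south r) \<notin> D"
  shows "rim (content r) = r"
  using rim_unique[OF _ assms(1) _ _ assms(2)] rim[of "content r"] assms by blast

lemma east_south_notin:
  assumes "x \<in> D" "east x \<notin> D \<or> south x \<notin> D"
  shows "east (south x) \<notin> D"
proof
  assume "east (south x) \<in> D"
  then have "east x \<in> D" "south x \<in> D"
    using D_ideal[of "east (south x)" "east x"] D_ideal[of "east (south x)" "south x"]
      D_pos[OF assms(1)] by (auto simp: cell_simps)
  then show False using assms(2) by blast
qed

lemma le_rim:
  assumes "x \<in> D"
  shows "fst x \<le> fst (rim (content x)) \<and> snd x \<le> snd (rim (content x))"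
proof -
  have r: "rim (content x) \<in> D" "content (rim (content x)) = content x"
    "east (south (rim (content x))) \<notin> D" using assms rim by blast+
  have "fst x \<le> fst (rim (content x))"
    using r D_ideal[OF assms, of "east (south (rim (content x)))"] D_pos[OF r(1)]
    by (auto simp: cell_simps not_le) force
  then show ?thesis using r(2) by (auto simp: content_def)
qed

text \<open>These two bits encode the type of a diagonal: both hold on \<open>I_cells\<close>,
  neither on \<open>O_cells\<close>, only \<open>rim_east\<close> on \<open>A_cells\<close>, only
  \<open>rim_south\<close> on \<open>B_cells\<close>.\<close>

definition rim_east :: "int \<Rightarrow> bool" where "rim_east c \<longleftrightarrow> east (rim c) \<in> D"
definition rim_south :: "int \<Rightarrow> bool" where "rim_south c \<longleftrightarrow> south (rim c) \<in> D"

text \<open>If the rim cell has no east neighbour, any cell of the larger content \<open>d\<close>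
  must lie in a higher row, so the north neighbour of the rim cell is in the diagram. The next rim
  cell has a south neighbour exactly when it was reached by a north step.\<close>

lemma rim_step:
  assumes "c \<in> contents" "d \<in> contents" "c < d"
  shows "c + 1 \<in> contents" "rim (c + 1) = (if rim_east c then east (rim c) else north (rim c))"
    "rim_south (c + 1) \<longleftrightarrow> \<not> rim_east c"
proof -
  note r = rim[OF assms(1)]
  define s where "s = (if rim_east c then east (rim c) else north (rim c))"
  have s: "s \<in> D \<and> content s = c + 1 \<and> east (south s) \<notin> D \<and> (south s \<in> D \<longleftrightarrow> \<not> rim_east c)"
  proof (cases "rim_east c")
    case True
    have "south s \<notin> D" using r(3) True by (simp add: s_def cell_simps)
    moreover have "s \<in> D" using True by (simp add: s_def rim_east_def)
    ultimately show ?thesis using east_south_notin True r by (auto simp: s_def)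
  next
    case False
    obtain x where x: "x \<in> D" "content x = d" using assms(2) by auto
    have "fst x < fst (rim c)"
    proof (rule ccontr)
      assume "\<not> fst x < fst (rim c)"
      then have "east (rim c) \<in> D"
        using D_ideal[OF x(1), of "east (rim c)"] x(2) r(2) D_pos[OF r(1)] assms(3)
        by (auto simp: cell_simps)
      then show False using False by (simp add: rim_east_def)
    qed
    then have "north (rim c) \<in> D"
      using D_ideal[OF r(1), of "north (rim c)"] D_pos[OF x(1)] D_pos[OF r(1)]
      by (auto simp: cell_simps)
    then show ?thesis using False r by (simp add: s_def rim_east_def)
  qed
  then show "c + 1 \<in> contents" by force
  show "rim (c + 1) = (if rim_east c then east (rim c) else north (rim c))"
    using s rim_eqI[of s] by (simp add: s_def)
  then show "rim_south (c + 1) \<longleftrightarrow> \<not> rim_east c" using s by (simp add: rim_south_def s_def)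
qed

lemma contents_convex:
  assumes "c \<in> contents" "d \<in> contents" "c \<le> e" "e \<le> d"
  shows "e \<in> contents"
  using assms(3,4)
proof (induction e rule: int_ge_induct)
  case base
  then show ?case using assms by simp
next
  case (step e)
  then show ?case using rim_step(1)[of e d] assms(2) by simp
qed

text \<open>By \<open>le_rim\<close>, \<open>x\<close> lies weakly north-west of its rim cell and
  inherits the east neighbour. The type of a diagonal thus controls cells off the rim too.\<close>

lemma east_in_D:
  assumes "x \<in> D" "rim_east (content x)"
  shows "east x \<in> D"
  using D_ideal[of "east (rim (content x))" "east x"] assms le_rim[OF assms(1)] D_pos[OF assms(1)]
  by (auto simp: rim_east_def cell_simps)

lemma rim_of_row_end:
  assumes "x \<in> D" "east x \<notin> D"
  shows "rim (content x) = x"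
  using assms east_south_notin by (intro rim_eqI) blast+

lemma not_rim_east_of_row_end:
  assumes "x \<in> D" "east x \<notin> D"
  shows "\<not> rim_east (content x)"
  using assms east_in_D by blast

section \<open>Corners and the four types of cells\<close>

lemma content_inner_corners: "content ` inner_corners lam = {c \<in> contents. rim_east c \<and> rim_south c}"
proof (intro set_eqI iffI)
  fix c assume "c \<in> content ` inner_corners lam"
  then obtain u where u: "c = content u" "east u \<in> D" "south u \<in> D" "east (south u) \<notin> D"
    by (auto simp: inner_corners_def)
  \<comment> \<open>The east neighbour shows that the row of \<open>u\<close> is positive, the south
    neighbour that its column is.\<close>
  then have "u \<in> D"
    using D_ideal[of "east u" u] D_pos[of "east u"] D_pos[of "south u"] by (auto simp: cell_simps)
  then show "c \<in> {c \<in> contents. rim_east c \<and> rim_south c}"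
    using u rim_eqI[of u] by (auto simp: rim_east_def rim_south_def)
next
  fix c assume "c \<in> {c \<in> contents. rim_east c \<and> rim_south c}"
  then have "rim c \<in> inner_corners lam" "content (rim c) = c"
    using rim[of c] by (auto simp: inner_corners_def rim_east_def rim_south_def)
  then show "c \<in> content ` inner_corners lam" by (metis image_eqI)
qed

lemma content_outer_corners:
  "content ` outer_corners lam = {c \<in> contents. \<not> rim_east c \<and> \<not> rim_south c}"
proof (intro set_eqI iffI)
  fix c assume "c \<in> content ` outer_corners lam"
  then obtain u where u: "c = content u" "u \<in> D" "east u \<notin> D" "south u \<notin> D"
    by (auto simp: outer_corners_def)
  then show "c \<in> {c \<in> contents. \<not> rim_east c \<and> \<not> rim_south c}"
    using rim_of_row_end[of u] by (auto simp: rim_east_def rim_south_def)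
next
  fix c assume "c \<in> {c \<in> contents. \<not> rim_east c \<and> \<not> rim_south c}"
  then have "rim c \<in> outer_corners lam" "content (rim c) = c"
    using rim[of c] by (auto simp: outer_corners_def rim_east_def rim_south_def)
  then show "c \<in> content ` outer_corners lam" by (metis image_eqI)
qed

definition inner_below :: "int \<Rightarrow> nat" where
  "inner_below c = card {x \<in> content ` inner_corners lam. x < c}"
definition outer_below :: "int \<Rightarrow> nat" where
  "outer_below c = card {x \<in> content ` outer_corners lam. x < c}"

lemma finite_corner_contents:
  "finite (content ` inner_corners lam)" "finite (content ` outer_corners lam)"
  using finite_contents by (auto simp: content_inner_corners content_outer_corners)

lemma inner_below_Suc:
  "c \<in> contents \<Longrightarrow> inner_below (c + 1) = inner_below c + of_bool (rim_east c \<and> rim_south c)"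
  using card_less_Suc[OF finite_corner_contents(1), of c]
  by (simp add: inner_below_def content_inner_corners)

lemma outer_below_Suc:
  "c \<in> contents \<Longrightarrow> outer_below (c + 1) = outer_below c + of_bool (\<not> rim_east c \<and> \<not> rim_south c)"
  using card_less_Suc[OF finite_corner_contents(2), of c]
  by (simp add: outer_below_def content_outer_corners)

text \<open>
  Inner and outer corners interlace because they are the ascents and descents of the
  0/1-sequence \<open>rim_east\<close>.
\<close>

lemma outer_below_eq_inner_below:
  assumes "c \<in> contents"
  shows "outer_below (c + 1) = inner_below (c + 1) + of_bool (\<not> rim_east c)"
proof -
  let ?a = "Min contents"
  have a: "?a \<in> contents" using assms finite_contents by (intro Min_in) auto
  have "?a \<le> c" using assms finite_contents by simp
  then show ?thesis using assms
  proof (induction c rule: int_ge_induct)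
    case base
    have "\<not> rim_south ?a"
    proof
      assume "rim_south ?a"
      then have "content (south (rim ?a)) \<in> contents"
        unfolding rim_south_def by (rule imageI)
      then have "?a \<le> content (south (rim ?a))" by (rule Min_le[OF finite_contents])
      then show False using content_rim[OF a] by simp
    qed
    moreover have "{x \<in> contents. x < ?a} = {}"
      using finite_contents by (auto simp: not_less intro!: Min_le)
    then have "inner_below ?a = 0" "outer_below ?a = 0"
      unfolding inner_below_def outer_below_def content_inner_corners content_outer_corners
      by (auto simp: card_eq_0_iff)
    ultimately show ?case using a by (simp add: inner_below_Suc outer_below_Suc)
  next
    case (step c)
    then have c: "c \<in> contents" using contents_convex[OF a] by fastforce
    have "outer_below (c + 1) = inner_below (c + 1) + of_bool (\<not> rim_east c)" using step.IH c by simp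
    \<comment> \<open>Since \<open>rim_south (c + 1)\<close> negates \<open>rim_east c\<close>, an
      inner corner at \<open>c + 1\<close> is a rise of the bit \<open>rim_east\<close> and an outer
      corner a fall.\<close>
    then show ?case
      using rim_step(3)[OF c step.prems] inner_below_Suc[OF step.prems] outer_below_Suc[OF step.prems]
      by (simp add: of_bool_def del: add.assoc)
  qed
qed

text \<open>Past the last diagonal, whose rim cell has no east neighbour, the counts are the totals.
  This keeps the index \<open>k + 1\<close> in \<open>A_cells\<close> within the list of outer
  contents.\<close>

lemma card_outer_contents:
  assumes "D \<noteq> {}"
  shows "card (content ` outer_corners lam) = card (content ` inner_corners lam) + 1"
proof -
  let ?b = "Max contents"
  have b: "?b \<in> contents" using assms finite_contents by (intro Max_in) auto
  have le: "x \<in> contents \<Longrightarrow> x < ?b + 1" for x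
    using Max_ge[OF finite_contents, of x] by linarith
  have "\<not> rim_east ?b"
  proof
    assume "rim_east ?b"
    then have "content (east (rim ?b)) \<in> contents"
      unfolding rim_east_def by (rule imageI)
    then show False using le content_rim[OF b] by fastforce
  qed
  moreover have "{x \<in> content ` inner_corners lam. x < ?b + 1} = content ` inner_corners lam"
    "{x \<in> content ` outer_corners lam. x < ?b + 1} = content ` outer_corners lam"
    unfolding content_inner_corners content_outer_corners using le by blast+
  ultimately show ?thesis
    using outer_below_eq_inner_below[OF b] by (simp add: inner_below_def outer_below_def)
qed

lemma inner_below_le: "inner_below c \<le> card (content ` inner_corners lam)"
  unfolding inner_below_def by (intro card_mono finite_corner_contents) auto

lemma I_cells_iff: "x \<in> D \<Longrightarrow> x \<in> I_cells lam \<longleftrightarrow> rim_east (content x) \<and> rim_south (content x)"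
  by (simp add: I_cells_def inner_contents_def finite_corner_contents)
    (simp add: content_inner_corners)

lemma O_cells_iff: "x \<in> D \<Longrightarrow> x \<in> O_cells lam \<longleftrightarrow> \<not> rim_east (content x) \<and> \<not> rim_south (content x)"
  by (simp add: O_cells_def outer_contents_def finite_corner_contents)
    (simp add: content_outer_corners)

text \<open>In counting form, membership says that no more outer corners lie weakly below the
  content than inner corners lie strictly below it. Interlacing turns this into a condition on the
  two bits.\<close>

lemma A_cells_iff:
  assumes "x \<in> D"
  shows "x \<in> A_cells lam \<longleftrightarrow> rim_east (content x) \<and> \<not> rim_south (content x)"
proof -
  let ?c = "content x"
  let ?r = "card (content ` inner_corners lam)"
  have c: "?c \<in> contents" using assms by simp
  have co: "card (content ` outer_corners lam) = ?r + 1" using card_outer_contents assms by blast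
  have o: "?c < outer_contents lam ! k \<longleftrightarrow> outer_below (?c + 1) \<le> k" if "k \<le> ?r" for k
    unfolding outer_contents_def outer_below_def
    using less_sorted_list_nth_iff[OF finite_corner_contents(2), of k] that co by simp
  have i: "inner_contents lam ! k < ?c \<longleftrightarrow> k < inner_below ?c" if "k < ?r" for k
    unfolding inner_contents_def inner_below_def
    using sorted_list_nth_less_iff[OF finite_corner_contents(1), of k] that by simp
  have len: "length (inner_contents lam) = ?r" by (simp add: inner_contents_def)
  have "x \<in> A_cells lam \<longleftrightarrow>
      outer_below (?c + 1) = 0 \<or> (\<exists>k<?r. k < inner_below ?c \<and> outer_below (?c + 1) \<le> k + 1)"
    using assms o[of 0] o i by (auto simp: A_cells_def len)
  also have "\<dots> \<longleftrightarrow> outer_below (?c + 1) \<le> inner_below ?c"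
  proof
    assume h: "outer_below (?c + 1) \<le> inner_below ?c"
    show "outer_below (?c + 1) = 0 \<or> (\<exists>k<?r. k < inner_below ?c \<and> outer_below (?c + 1) \<le> k + 1)"
    proof (cases "inner_below ?c")
      case 0
      then show ?thesis using h by simp
    next
      \<comment> \<open>The witness is the last inner corner strictly below the content; its index
        is one less than their number.\<close>
      case (Suc k)
      then show ?thesis using h inner_below_le[of ?c] by (intro disjI2 exI[of _ k]) auto
    qed
  qed auto
  also have "\<dots> \<longleftrightarrow> rim_east ?c \<and> \<not> rim_south ?c"
    using outer_below_eq_inner_below[OF c] inner_below_Suc[OF c] by auto
  finally show ?thesis .
qed

lemma B_cells_iff:
  assumes "x \<in> D"
  shows "x \<in> B_cells lam \<longleftrightarrow> \<not> rim_east (content x) \<and> rim_south (content x)"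
proof -
  let ?c = "content x"
  let ?r = "card (content ` inner_corners lam)"
  have c: "?c \<in> contents" using assms by simp
  have co: "card (content ` outer_corners lam) = ?r + 1" using card_outer_contents assms by blast
  have o: "outer_contents lam ! k < ?c \<longleftrightarrow> k < outer_below ?c" if "k \<le> ?r" for k
    unfolding outer_contents_def outer_below_def
    using sorted_list_nth_less_iff[OF finite_corner_contents(2), of k] that co by simp
  have i: "?c < inner_contents lam ! k \<longleftrightarrow> inner_below (?c + 1) \<le> k" if "k < ?r" for k
    unfolding inner_contents_def inner_below_def
    using less_sorted_list_nth_iff[OF finite_corner_contents(1), of k] that by simp
  have len: "length (inner_contents lam) = ?r" by (simp add: inner_contents_def)
  have "x \<in> B_cells lam \<longleftrightarrow>
      (\<exists>k<?r. k < outer_below ?c \<and> inner_below (?c + 1) \<le> k) \<or> ?r < outer_below ?c"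
    using assms o[of ?r] o i by (auto simp: B_cells_def len)
  \<comment> \<open>The witness is \<open>k = inner_below (?c + 1)\<close>, the first inner corner
    above the content; if there is none, this number is \<open>?r\<close> and the second disjunct
    holds.\<close>
  also have "\<dots> \<longleftrightarrow> inner_below (?c + 1) < outer_below ?c"
    using inner_below_le[of "?c + 1"] by (auto simp: nat_less_le)
  also have "\<dots> \<longleftrightarrow> \<not> rim_east ?c \<and> rim_south ?c"
    using outer_below_eq_inner_below[OF c] outer_below_Suc[OF c]
    by (auto simp: of_bool_def split: if_splits)
  finally show ?thesis .
qed

lemmas cells_iff = I_cells_iff O_cells_iff A_cells_iff B_cells_iff

lemma cells_subset: "I_cells lam \<subseteq> D" "O_cells lam \<subseteq> D" "A_cells lam \<subseteq> D" "B_cells lam \<subseteq> D"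
  by (auto simp: I_cells_def O_cells_def A_cells_def B_cells_def)

section \<open>Rim-hooks as intervals of the rim\<close>

text \<open>Every cell of a rim-hook is the rim cell of its diagonal and contents rise by one, so
  the contents of the two ends determine the hook.\<close>

lemma rim_hook_eq_map:
  assumes "rim_hook lam h"
  shows "h = map rim [content (hd h)..content (last h)]"
proof (rule nth_equalityI)
  have p: "ne_path lam h" using assms by (simp add: rim_hook_def)
  then have "h \<noteq> []" by (simp add: ne_path_def)
  then show len: "length h = length (map rim [content (hd h)..content (last h)])"
    using ne_path_content_last[OF p] by (cases h) (auto simp: path_length_def)
  fix k assume k: "k < length h"
  then have "h ! k \<in> set h" by simp
  then have "rim (content (h ! k)) = h ! k"
    using assms by (intro rim_eqI) (auto simp: rim_hook_def ne_path_def)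
  then show "h ! k = map rim [content (hd h)..content (last h)] ! k"
    using ne_path_content_nth[OF p k] k len by (simp add: nth_upto)
qed

lemma rim_hook_map:
  assumes "c \<in> contents" "d \<in> contents" "c \<le> d" "\<not> rim_south c" "\<not> rim_east d"
  shows "rim_hook lam (map rim [c..d])"
proof -
  let ?h = "map rim [c..d]"
  have mem: "e \<in> contents" if "c \<le> e" "e \<le> d" for e
    using contents_convex[OF assms(1,2)] that .
  have "hd ?h = rim c" using assms(3) by (simp add: upto_rec1)
  moreover have "last ?h = rim d" using assms(3) by (simp add: upto_rec2)
  moreover have "?h \<noteq> []" using assms(3) by simp
  moreover have "set ?h \<subseteq> D" using mem rim_in_D by auto
  moreover have "\<forall>u \<in> set ?h. east (south u) \<notin> D" using mem east_south_rim by auto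
  moreover have "successively (\<lambda>u u'. u' = north u \<or> u' = east u) ?h"
    unfolding successively_conv_nth
  proof (intro allI impI)
    fix k assume k: "Suc k < length ?h"
    then have "rim (c + int k + 1) = north (rim (c + int k)) \<or> rim (c + int k + 1) = east (rim (c + int k))"
      using rim_step(2)[OF mem[of "c + int k"] assms(2)] by auto
    then show "?h ! Suc k = north (?h ! k) \<or> ?h ! Suc k = east (?h ! k)"
      using k by (simp add: nth_upto add_ac)
  qed
  ultimately show ?thesis
    using assms(4,5) by (simp add: rim_hook_def ne_path_def ne_head_def ne_tail_def rim_south_def rim_east_def)
qed

text \<open>Tail and length fix the content of the head. This gives the unique existence behind the
  \<open>THE\<close> in \<open>cand_hook\<close>.\<close>

lemma rim_hook_of_path:
  assumes p: "ne_path lam q" and "\<not> rim_south (content (hd q))" "east (last q) \<notin> D"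
  shows "rim_hook lam h \<and> ne_tail h = ne_tail q \<and> path_length h = path_length q \<longleftrightarrow>
    h = map rim [content (hd q)..content (last q)]"
proof
  assume h: "rim_hook lam h \<and> ne_tail h = ne_tail q \<and> path_length h = path_length q"
  then have "ne_path lam h" by (simp add: rim_hook_def)
  then have "content (hd h) = content (hd q)"
    using ne_path_content_last[OF p] ne_path_content_last[of lam h] h by (simp add: ne_tail_def)
  then show "h = map rim [content (hd q)..content (last q)]"
    using rim_hook_eq_map[of h] h by (simp add: ne_tail_def)
next
  let ?h = "map rim [content (hd q)..content (last q)]"
  assume h: "h = ?h"
  have q: "hd q \<in> D" "last q \<in> D" using p by (auto simp: ne_path_def)
  have le: "content (hd q) \<le> content (last q)" using ne_path_content_last[OF p] by simp
  have "rim_hook lam h"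
    unfolding h using q le assms not_rim_east_of_row_end by (intro rim_hook_map) auto
  moreover have "last ?h = last q"
    using le rim_of_row_end[OF q(2) assms(3)] by (simp add: upto_rec2)
  moreover have "path_length ?h = path_length q"
    using ne_path_content_last[OF p] by (simp add: path_length_def)
  ultimately show "rim_hook lam h \<and> ne_tail h = ne_tail q \<and> path_length h = path_length q"
    using h by (simp add: ne_tail_def)
qed

text \<open>The index cell takes its row from the tail and its column from the head. If the head
  were in a column right of the tail, its row would also be lower, putting the south-east neighbour
  of the tail in the diagram.\<close>

lemma rim_hook_at_map:
  assumes "c \<in> contents" "d \<in> contents" "c \<le> d" "\<not> rim_south c" "\<not> rim_east d"
  shows "rim_hook_at lam (fst (rim d), snd (rim c)) (map rim [c..d])"
proof -
  let ?h = "map rim [c..d]"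
  note rc = rim[OF assms(1)] and rd = rim[OF assms(2)]
  have "snd (rim c) \<le> snd (rim d)"
  proof (rule ccontr)
    assume "\<not> snd (rim c) \<le> snd (rim d)"
    then have "east (south (rim d)) \<in> D"
      using D_ideal[OF rc(1), of "east (south (rim d))"] D_pos[OF rd(1)] rc(2) rd(2) assms(3)
      by (auto simp: cell_simps)
    then show False using rd(3) by simp
  qed
  then have "(fst (rim d), snd (rim c)) \<in> D"
    using D_ideal[OF rd(1)] D_pos[OF rd(1)] D_pos[OF rc(1)] by simp
  moreover have "hd ?h = rim c" using assms(3) by (simp add: upto_rec1)
  moreover have "last ?h = rim d" using assms(3) by (simp add: upto_rec2)
  ultimately show ?thesis
    using rim_hook_map[OF assms] column_end[OF rc(1)] row_end[OF rd(1)] assms(4,5)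
    by (auto simp: rim_hook_at_def ne_head_def ne_tail_def rim_south_def rim_east_def)
qed

text \<open>Otherwise \<open>rim c\<close> would lie in a lower row and weakly to the right of
  \<open>rim d\<close>, forcing a south neighbour of \<open>rim d\<close>. Hence hooks with heads on
  different diagonals are compared by column alone.\<close>

lemma snd_rim_less:
  assumes "c \<in> contents" "d \<in> contents" "c < d" "\<not> rim_south d"
  shows "snd (rim c) < snd (rim d)"
proof (rule ccontr)
  note rc = rim[OF assms(1)] and rd = rim[OF assms(2)]
  assume "\<not> snd (rim c) < snd (rim d)"
  then have "south (rim d) \<in> D"
    using D_ideal[OF rc(1), of "south (rim d)"] D_pos[OF rd(1)] rc(2) rd(2) assms(3)
    by (auto simp: cell_simps)
  then show False using assms(4) by (simp add: rim_south_def)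
qed

end

section \<open>Candidates of a reverse plane partition\<close>

locale rpp = young_diagram +
  fixes \<pi> :: "cell \<Rightarrow> int"
  assumes is_rpp: "is_rpp lam \<pi>"
begin

text \<open>Integer counterpart of \<open>val\<close> on the diagram and its zero boundary. At
  outside cells with positive coordinates it is the raw value of \<open>\<pi>\<close>, not
  infinity.\<close>

definition ext :: "cell \<Rightarrow> int" where
  "ext x = (if fst x \<le> 0 \<or> snd x \<le> 0 then 0 else \<pi> x)"

lemma ext_in_D: "x \<in> D \<Longrightarrow> ext x = \<pi> x"
  using D_pos[of x] by (simp add: ext_def)

lemma ext_nonneg: "x \<in> D \<Longrightarrow> 0 \<le> ext x"
  using is_rpp by (simp add: ext_in_D is_rpp_def)

lemma val_in_D: "x \<in> D \<Longrightarrow> val lam \<pi> x = Fin (ext x)"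
  using D_pos[of x] by (simp add: val_def ext_def)

lemma north_cases: "x \<in> D \<Longrightarrow> north x \<in> D \<or> fst (north x) \<le> 0"
  using D_ideal[of x "north x"] D_pos[of x] by (auto simp: cell_simps)

lemma west_cases: "x \<in> D \<Longrightarrow> west x \<in> D \<or> snd (west x) \<le> 0"
  using D_ideal[of x "west x"] D_pos[of x] by (auto simp: cell_simps)

lemma val_north: "x \<in> D \<Longrightarrow> val lam \<pi> (north x) = Fin (ext (north x))"
  using north_cases[of x] val_in_D[of "north x"] by (auto simp: val_def ext_def zero_extended_def)

lemma val_west: "x \<in> D \<Longrightarrow> val lam \<pi> (west x) = Fin (ext (west x))"
  using west_cases[of x] val_in_D[of "west x"] by (auto simp: val_def ext_def zero_extended_def)

lemma ext_east: "x \<in> D \<Longrightarrow> east x \<in> D \<Longrightarrow> ext x \<le> ext (east x)"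
  using is_rpp by (auto simp: is_rpp_def val_in_D)

lemma ext_south: "x \<in> D \<Longrightarrow> south x \<in> D \<Longrightarrow> ext x \<le> ext (south x)"
  using is_rpp by (auto simp: is_rpp_def val_in_D)

lemma ext_north: "x \<in> D \<Longrightarrow> ext (north x) \<le> ext x"
  using north_cases[of x] ext_south[of "north x"] ext_nonneg[of x] by (auto simp: ext_def)

lemma ext_west: "x \<in> D \<Longrightarrow> ext (west x) \<le> ext x"
  using west_cases[of x] ext_east[of "west x"] ext_nonneg[of x] by (auto simp: ext_def)

lemma ext_north_west: "x \<in> D \<Longrightarrow> ext (north (west x)) \<le> ext (west x)"
  using west_cases[of x] ext_north[of "west x"] by (auto simp: ext_def cell_simps)

lemma ext_north_west_nonneg: "x \<in> D \<Longrightarrow> 0 \<le> ext (north (west x))"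
  using D_ideal[of x "north (west x)"] ext_nonneg[of "north (west x)"]
  by (cases "north (west x) \<in> D") (auto simp: north_def west_def ext_def)

text \<open>Above the first row \<open>ext\<close> is 0, so a positive value cannot repeat
  there.\<close>

lemma north_in_D:
  assumes "x \<in> D" "0 < ext x" "ext (north x) = ext x"
  shows "north x \<in> D"
  using assms north_cases[of x] by (auto simp: ext_def split: if_splits)

text \<open>\<open>O_cells\<close> and \<open>A_cells\<close> together are the diagonals without
  \<open>rim_south\<close>, and \<open>rim_east\<close> singles out the latter, so the two clauses
  merge.\<close>

lemma cand_iff:
  "x \<in> cand lam \<pi> \<longleftrightarrow> x \<in> D \<and> \<not> rim_south (content x) \<and> ext (west x) < ext x \<and>
    (rim_east (content x) \<longrightarrow> ext (north x) < ext x)"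
proof (cases "x \<in> D")
  case True
  then show ?thesis by (auto simp: cand_def cells_iff val_in_D val_north val_west)
next
  case False
  then show ?thesis using cells_subset by (auto simp: cand_def)
qed

lemma cand_pos:
  assumes "x \<in> cand lam \<pi>"
  shows "0 < ext x"
  using assms west_cases[of x] ext_nonneg[of "west x"] by (auto simp: cand_iff ext_def split: if_splits)

text \<open>On \<open>I_cells\<close> and \<open>A_cells\<close>, the diagonals with
  \<open>rim_east\<close>, the step is east. Elsewhere the comparison with the north neighbour
  decides, equality and strictness being complementary by \<open>ext_north\<close>.\<close>

lemma Q_step_iff:
  assumes "x \<in> D"
  shows "Q_step lam \<pi> x y \<longleftrightarrow>
    (if \<not> rim_east (content x) \<and> ext (north x) = ext x then y = north x
     else east x \<in> D \<and> y = east x)"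
  using assms ext_north[OF assms] east_in_D[OF assms]
  by (auto simp: Q_step_def cells_iff val_in_D val_north)

lemma Q_stop_iff:
  assumes "x \<in> D"
  shows "Q_stop lam \<pi> x \<longleftrightarrow> ext (north x) < ext x \<and> east x \<notin> D"
  using assms by (simp add: Q_stop_def val_in_D val_north)

section \<open>Existence and uniqueness of the path Q\<close>

definition Q_path_from :: "cell \<Rightarrow> cell list \<Rightarrow> bool" where
  "Q_path_from v q \<longleftrightarrow> ne_path lam q \<and> hd q = v
    \<and> successively (Q_step lam \<pi>) q \<and> Q_stop lam \<pi> (last q)"

text \<open>Contents increase along steps and are bounded. Values do not decrease, so they stay
  positive and a north step never leaves the diagram.\<close>

lemma Q_path_from_exists:
  assumes "x \<in> D" "0 < ext x"
  shows "\<exists>q. Q_path_from x q"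
  using assms
proof (induction "nat (Max contents - content x)" arbitrary: x rule: less_induct)
  case less
  show ?case
  proof (cases "Q_stop lam \<pi> x")
    case True
    then show ?thesis using less.prems by (intro exI[of _ "[x]"]) (simp add: Q_path_from_def ne_path_def)
  next
    case False
    define y where "y = (if \<not> rim_east (content x) \<and> ext (north x) = ext x then north x else east x)"
    have y: "y \<in> D \<and> Q_step lam \<pi> x y \<and> (y = north x \<or> y = east x) \<and> ext x \<le> ext y"
      using False less.prems north_in_D[of x] ext_north[of x] east_in_D[of x] ext_east[of x]
      by (auto simp: y_def Q_step_iff Q_stop_iff)
    then have "content y = content x + 1" "content y \<le> Max contents"
      using finite_contents by auto
    then obtain q where "Q_path_from y q" using less.hyps[of y] y less.prems by auto
    then have "Q_path_from x (x # q)"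
      using y less.prems by (cases q) (auto simp: Q_path_from_def ne_path_def)
    then show ?thesis by blast
  qed
qed

text \<open>Stopping and stepping exclude each other, and a step has only one possible
  target.\<close>

lemma Q_path_from_unique:
  assumes "Q_path_from x q" "Q_path_from x q'"
  shows "q = q'"
  using assms
proof (induction q arbitrary: x q')
  case Nil
  then show ?case by (simp add: Q_path_from_def ne_path_def)
next
  case (Cons a q)
  have a: "a = x" "x \<in> D" using Cons.prems by (auto simp: Q_path_from_def ne_path_def)
  obtain p' where q': "q' = x # p'"
    using Cons.prems(2) by (cases q') (auto simp: Q_path_from_def ne_path_def)
  have rest: "(p = [] \<and> Q_stop lam \<pi> x) \<or> (p \<noteq> [] \<and> Q_step lam \<pi> x (hd p) \<and> Q_path_from (hd p) p)"
    if "Q_path_from x (x # p)" for p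
    using that by (cases p) (auto simp: Q_path_from_def ne_path_def)
  have excl: "\<not> (Q_stop lam \<pi> x \<and> Q_step lam \<pi> x y)" for y
    using a(2) east_in_D[of x] by (auto simp: Q_stop_iff Q_step_iff)
  have det: "Q_step lam \<pi> x y \<Longrightarrow> Q_step lam \<pi> x z \<Longrightarrow> y = z" for y z
    using a(2) by (auto simp: Q_step_iff split: if_splits)
  have "q = p'"
  proof (cases "Q_stop lam \<pi> x")
    case True
    then show ?thesis using rest[of q] rest[of p'] excl Cons.prems a q' by auto
  next
    case False
    then have *: "Q_step lam \<pi> x (hd q)" "Q_path_from (hd q) q" "Q_step lam \<pi> x (hd p')" "Q_path_from (hd p') p'"
      using rest[of q] rest[of p'] Cons.prems a q' by auto
    then show ?thesis using Cons.IH[of "hd q" p'] det[of "hd q" "hd p'"] by auto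
  qed
  then show ?case using a q' by simp
qed

lemma Q_path:
  assumes "v \<in> cand lam \<pi>"
  shows "Q_path_from v (Q_path lam v \<pi>)"
proof -
  have "\<exists>!q. Q_path_from v q"
    using Q_path_from_exists[of v] Q_path_from_unique[of v] cand_pos[OF assms] assms
    by (blast dest: cand_iff[THEN iffD1])
  from theI'[OF this] show ?thesis
    by (simp add: Q_path_def Q_path_from_def ne_head_def ne_tail_def)
qed

lemma Q_path_facts:
  assumes "v \<in> cand lam \<pi>"
  defines "q \<equiv> Q_path lam v \<pi>"
  shows "ne_path lam q" "hd q = v" "last q \<in> D" "east (last q) \<notin> D" "content v \<le> content (last q)"
    "cand_hook lam v \<pi> = map rim [content v..content (last q)]"
proof -
  have q: "Q_path_from v q" using Q_path[OF assms(1)] by (simp add: q_def)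
  show p: "ne_path lam q" and v: "hd q = v" using q by (auto simp: Q_path_from_def)
  show l: "last q \<in> D" using p by (auto simp: ne_path_def)
  show e: "east (last q) \<notin> D" using q l by (simp add: Q_path_from_def Q_stop_iff)
  show "content v \<le> content (last q)" using ne_path_content_last[OF p] v by simp
  show "cand_hook lam v \<pi> = map rim [content v..content (last q)]"
    using rim_hook_of_path[OF p _ e] assms(1) v by (simp add: cand_hook_def cand_iff q_def)
qed

lemma rim_hook_at_cand_hook:
  assumes "v \<in> cand lam \<pi>"
  shows "rim_hook_at lam (fst (rim (content (last (Q_path lam v \<pi>)))), snd (rim (content v)))
    (cand_hook lam v \<pi>)"
  using Q_path_facts[OF assms] assms not_rim_east_of_row_end rim_hook_at_map by (simp add: cand_iff)

text \<open>The head of each hook is the rim cell on the diagonal of its candidate, so larger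
  content puts the head strictly to the right by \<open>snd_rim_less\<close>.\<close>

lemma rim_hook_le_cand_hook:
  assumes "u \<in> cand lam \<pi>" "v \<in> cand lam \<pi>" "u = v \<or> content u < content v"
  shows "rim_hook_le lam (cand_hook lam v \<pi>) (cand_hook lam u \<pi>)"
proof -
  have "u = v \<or> snd (rim (content u)) < snd (rim (content v))"
    using assms snd_rim_less by (auto simp: cand_iff)
  then show ?thesis
    using rim_hook_at_cand_hook[OF assms(1)] rim_hook_at_cand_hook[OF assms(2)]
    unfolding rim_hook_le_def revlex_le_def by fastforce
qed

section \<open>Consequences of maximal content\<close>

text \<open>A failure at \<open>x\<close>, which is no candidate, forces \<open>rim_east\<close> and
  an equal value to the north. The diagonal after one with \<open>rim_east\<close> has no
  \<open>rim_south\<close>, so induction applies to \<open>north x\<close> and makes the north-west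
  value equal to that of \<open>x\<close>, above the west value.\<close>

lemma ext_west_eq:
  assumes "\<forall>v \<in> cand lam \<pi>. content v \<le> c"
    and "x \<in> D" "c < content x" "\<not> rim_south (content x)"
  shows "ext (west x) = ext x"
  using assms(2-)
proof (induction "nat (fst x)" arbitrary: x rule: less_induct)
  case less
  show ?case
  proof (rule ccontr)
    assume "ext (west x) \<noteq> ext x"
    then have w: "ext (west x) < ext x" using ext_west[OF less.prems(1)] by simp
    have "x \<notin> cand lam \<pi>" using assms(1) less.prems(2) by fastforce
    then have r: "rim_east (content x)" and n: "ext (north x) = ext x"
      using less.prems w ext_north[OF less.prems(1)] by (auto simp: cand_iff)
    have "0 < ext x" using w west_cases[OF less.prems(1)] ext_nonneg[of "west x"]
      by (auto simp: ext_def split: if_splits)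
    then have nD: "north x \<in> D" using north_in_D less.prems n by simp
    have "content x \<in> contents" "content (north x) \<in> contents" using nD less.prems by blast+
    then have "\<not> rim_south (content (north x))" using rim_step(3) r by simp
    moreover have "nat (fst (north x)) < nat (fst x)" using D_pos[OF less.prems(1)] by (simp add: north_def)
    ultimately have "ext (west (north x)) = ext (north x)" using less.hyps nD less.prems by simp
    moreover have "west (north x) = north (west x)" by (simp add: cell_simps)
    ultimately show False using ext_north_west[OF less.prems(1)] w n by simp
  qed
qed

section \<open>Subtracting the path of a candidate of maximal content\<close>

context
  fixes v q
  assumes v: "v \<in> cand lam \<pi>" and maximal: "\<forall>w \<in> cand lam \<pi>. content w \<le> content v"
    and q: "Q_path_from v q"
begin

lemma q_path: "ne_path lam q" and hd_q: "hd q = v" and q_nonempty: "q \<noteq> []" and q_in_D: "set q \<subseteq> D"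
  using q by (auto simp: Q_path_from_def ne_path_def)

lemma q_step: "Suc k < length q \<Longrightarrow> Q_step lam \<pi> (q ! k) (q ! Suc k)"
  using q by (auto simp: Q_path_from_def successively_conv_nth)

lemma q_nth_in_D: "k < length q \<Longrightarrow> q ! k \<in> D"
  using q_in_D by auto

lemma content_q_nth: "k < length q \<Longrightarrow> content (q ! k) = content v + int k"
  using ne_path_content_nth[OF q_path] hd_q by simp

text \<open>Both \<open>east x\<close> and, if in the diagram, \<open>north x\<close> lie on a
  diagonal without \<open>rim_south\<close>, where \<open>ext_west_eq\<close> applies. Equality with
  the north value would then carry over to the north-west cell.\<close>

lemma east_of_rim_east:
  assumes "x \<in> D" "content v \<le> content x" "rim_east (content x)"
  shows "ext (east x) = ext x" and "ext (north (west x)) < ext x \<Longrightarrow> ext (north x) < ext x"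
proof -
  have next_type: "\<not> rim_south (content x + 1)" if "y \<in> D" "content y = content x + 1" for y
  proof -
    have "content x \<in> contents" "content x + 1 \<in> contents" using assms(1) that by force+
    then show ?thesis using rim_step(3) assms(3) by simp
  qed
  have e: "east x \<in> D" using east_in_D assms by simp
  show "ext (east x) = ext x"
    using ext_west_eq[OF maximal e] next_type[OF e] assms(2) by simp
  assume k: "ext (north (west x)) < ext x"
  show "ext (north x) < ext x"
  proof (rule ccontr)
    assume "\<not> ext (north x) < ext x"
    then have n: "ext (north x) = ext x" using ext_north[OF assms(1)] by simp
    have "0 < ext x" using k ext_north_west_nonneg[OF assms(1)] by simp
    then have nD: "north x \<in> D" using north_in_D assms(1) n by simp
    then have "ext (west (north x)) = ext (north x)"
      using ext_west_eq[OF maximal nD] next_type[OF nD] assms(2) by simp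
    moreover have "west (north x) = north (west x)" by (simp add: cell_simps)
    ultimately show False using k n by simp
  qed
qed

text \<open>A candidate exceeds its west value, hence its north-west value. A north step keeps the
  value while the north-west cell moves up; after an east step that cell is the old north neighbour,
  which is strictly smaller by the step rule or by \<open>east_of_rim_east\<close>.\<close>

lemma q_invariant:
  assumes "k < length q"
  shows "ext (north (west (q ! k))) < ext (q ! k)"
  using assms
proof (induction k)
  case 0
  have "q ! 0 = v" using hd_q q_nonempty by (simp add: hd_conv_nth)
  then show ?case using ext_north_west[of v] v by (auto simp: cand_iff)
next
  case (Suc k)
  let ?x = "q ! k"
  have x: "?x \<in> D" "content v \<le> content ?x" using Suc.prems q_nth_in_D content_q_nth by auto
  have K: "ext (north (west ?x)) < ext ?x" using Suc by simp
  have s: "Q_step lam \<pi> ?x (q ! Suc k)" using q_step Suc.prems by simp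
  show ?case
  proof (cases "\<not> rim_east (content ?x) \<and> ext (north ?x) = ext ?x")
    case True
    then have y: "q ! Suc k = north ?x" using s x by (simp add: Q_step_iff)
    have "ext (north (west (north ?x))) \<le> ext (north (west ?x))"
      using ext_north_west[of "north ?x"] q_nth_in_D[OF Suc.prems] y by (simp add: cell_simps)
    then show ?thesis using y K True by simp
  next
    case False
    then have y: "q ! Suc k = east ?x" "east ?x \<in> D" using s x by (auto simp: Q_step_iff split: if_splits)
    have "ext (north ?x) < ext ?x"
      using False K east_of_rim_east(2)[OF x] ext_north[OF x(1)] by fastforce
    then show ?thesis using y ext_east[OF x(1)] by simp
  qed
qed

text \<open>If the next step is east, strictness comes from the step rule or, on diagonals with
  \<open>rim_east\<close>, from the invariant; at the last cell it is the stopping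
  condition.\<close>

lemma q_north:
  assumes "x \<in> set q" "north x \<notin> set q"
  shows "ext (north x) < ext x"
proof -
  obtain k where k: "k < length q" "x = q ! k" using assms(1) by (auto simp: in_set_conv_nth)
  have x: "x \<in> D" "content v \<le> content x" using k q_nth_in_D content_q_nth by auto
  show ?thesis
  proof (cases "Suc k < length q")
    case True
    then have "q ! Suc k \<noteq> north x" using assms(2) by (metis nth_mem)
    then have "\<not> (\<not> rim_east (content x) \<and> ext (north x) = ext x)"
      using q_step[OF True] x k by (auto simp: Q_step_iff)
    then show ?thesis using east_of_rim_east(2)[OF x] q_invariant[OF k(1)] k ext_north[OF x(1)] by fastforce
  next
    case False
    then have "x = last q" using k q_nonempty by (metis Suc_lessI diff_Suc_1 last_conv_nth)
    then show ?thesis using q x by (simp add: Q_path_from_def Q_stop_iff)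
  qed
qed

text \<open>Such an \<open>x\<close> is the candidate itself or was entered from the south with
  unchanged value; then \<open>west x\<close> is the north-west cell of the predecessor and the
  invariant applies.\<close>

lemma q_west:
  assumes "x \<in> set q" "west x \<notin> set q"
  shows "ext (west x) < ext x"
proof -
  obtain k where k: "k < length q" "x = q ! k" using assms(1) by (auto simp: in_set_conv_nth)
  show ?thesis
  proof (cases k)
    case 0
    then have "x = v" using k hd_q q_nonempty by (simp add: hd_conv_nth)
    then show ?thesis using v by (simp add: cand_iff)
  next
    case (Suc j)
    then have j: "q ! j \<in> set q" "q ! j \<in> D" "j < length q" using k q_nth_in_D by auto
    then have "x \<noteq> east (q ! j)" using assms(2) by auto
    then have "x = north (q ! j)" "ext (north (q ! j)) = ext (q ! j)"
      using q_step[of j] k Suc j by (auto simp: Q_step_iff split: if_splits)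
    moreover have "west (north (q ! j)) = north (west (q ! j))" by (simp add: cell_simps)
    ultimately show ?thesis using q_invariant[of j] j by simp
  qed
qed

text \<open>The path cannot stop at \<open>x\<close>, which has an east neighbour, so it continues
  there; equality of values comes from maximality.\<close>

lemma q_east:
  assumes "x \<in> set q" "rim_east (content x)"
  shows "east x \<in> set q" "ext (east x) = ext x"
proof -
  obtain k where k: "k < length q" "x = q ! k" using assms(1) by (auto simp: in_set_conv_nth)
  have x: "x \<in> D" "content v \<le> content x" using k q_nth_in_D content_q_nth by auto
  show "ext (east x) = ext x" using east_of_rim_east(1)[OF x assms(2)] .
  have "Suc k < length q"
  proof (rule ccontr)
    assume "\<not> Suc k < length q"
    then have "x = last q" using k q_nonempty by (metis Suc_lessI diff_Suc_1 last_conv_nth)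
    then show False using q x east_in_D assms(2) by (simp add: Q_path_from_def Q_stop_iff)
  qed
  moreover from this have "q ! Suc k = east x" using q_step[of k] k x assms(2) by (simp add: Q_step_iff)
  ultimately show "east x \<in> set q" by (metis nth_mem)
qed

text \<open>By contents \<open>x\<close> directly follows \<open>south x\<close> on the path, so
  that step is a north step, taken only at equal values.\<close>

lemma q_south:
  assumes "x \<in> set q" "south x \<in> set q"
  shows "ext x = ext (south x)"
proof -
  obtain k where k: "k < length q" "south x = q ! k" using assms(2) by (auto simp: in_set_conv_nth)
  obtain l where l: "l < length q" "x = q ! l" using assms(1) by (auto simp: in_set_conv_nth)
  have "l = Suc k" using content_q_nth[OF k(1)] content_q_nth[OF l(1)] k l
    by (metis (no_types, lifting) content_step(3) diff_add_cancel add.assoc add_left_cancel of_nat_Suc of_nat_eq_iff add.commute)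
  moreover have "x \<noteq> east (south x)" by (auto simp: cell_simps prod_eq_iff)
  ultimately show ?thesis
    using q_step[of k] k l q_nth_in_D[of k] by (auto simp: Q_step_iff split: if_splits)
qed

lemma compatible_q: "compatible lam (rev q) \<pi>"
proof -
  have "east x \<in> set q \<and> val lam \<pi> x = val lam \<pi> (east x)"
    if "x \<in> set q" "x \<in> I_cells lam \<union> A_cells lam" for x
  proof -
    have "x \<in> D" "rim_east (content x)" using that q_in_D by (auto simp: cells_iff)
    then show ?thesis using q_east[OF that(1)] q_in_D by (auto simp: val_in_D)
  qed
  moreover have "val lam \<pi> x = val lam \<pi> (south x)" if "x \<in> set q" "south x \<in> set q" for x
    using q_south[OF that] val_in_D subsetD[OF q_in_D that(1)] subsetD[OF q_in_D that(2)] by simp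
  ultimately show ?thesis by (simp add: compatible_def)
qed

lemma q_pos:
  assumes "x \<in> set q"
  shows "0 < ext x"
proof -
  obtain k where k: "k < length q" "x = q ! k" using assms by (auto simp: in_set_conv_nth)
  then show ?thesis using q_invariant[OF k(1)] ext_north_west_nonneg[of x] q_nth_in_D by simp
qed

text \<open>An inequality can break only where the larger cell is on the path and the smaller one is
  not; there \<open>q_west\<close> and \<open>q_north\<close> provide strictness.\<close>

lemma is_rpp_minus_q: "is_rpp lam (minus_path \<pi> (rev q))"
proof -
  let ?m = "minus_path \<pi> (rev q)"
  have m: "?m x = ext x - of_bool (x \<in> set q)" if "x \<in> D" for x
    using that by (simp add: minus_path_def ext_in_D)
  have val_m: "val lam ?m x = Fin (?m x)" if "x \<in> D" for x
    using that D_pos[of x] by (simp add: val_def)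
  have val_out: "val lam ?m x = Pinf" if "x \<notin> D" "1 \<le> fst x" "1 \<le> snd x" for x
    using that by (simp add: val_def)
  have "0 \<le> ?m x \<and> val lam ?m x \<le> val lam ?m (east x) \<and> val lam ?m x \<le> val lam ?m (south x)"
    if x: "x \<in> D" for x
  proof (intro conjI)
    show "0 \<le> ?m x" using x ext_nonneg[OF x] q_pos[of x] by (auto simp: m)
    show "val lam ?m x \<le> val lam ?m (east x)"
    proof (cases "east x \<in> D")
      case True
      then show ?thesis using x q_west[of "east x"] ext_east[OF x] by (auto simp: val_m m)
    next
      case False
      then show ?thesis using val_out[of "east x"] D_pos[OF x] by (simp add: east_def)
    qed
    show "val lam ?m x \<le> val lam ?m (south x)"
    proof (cases "south x \<in> D")
      case True
      then show ?thesis using x q_north[of "south x"] ext_south[OF x] by (auto simp: val_m m)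
    next
      case False
      then show ?thesis using val_out[of "south x"] D_pos[OF x] by (simp add: south_def)
    qed
  qed
  then show ?thesis by (simp add: is_rpp_def)
qed

lemma sw_path_q: "sw_path lam (rev q)"
proof -
  have "u = south u' \<or> u = west u'" if "u' = north u \<or> u' = east u" for u u' using that by auto
  then have "successively (\<lambda>u u'. u = south u' \<or> u = west u') q"
    using q_path unfolding ne_path_def by (blast intro: successively_mono)
  then show ?thesis using q_nonempty q_in_D by (simp add: sw_path_def successively_rev)
qed

end

text \<open>The reversal of \<open>Q_path lam v \<pi>\<close> serves as the south-west path in the
  definition of a factor.\<close>

lemma cand_hook_in_factors:
  assumes "v \<in> cand lam \<pi>" "\<forall>w \<in> cand lam \<pi>. content w \<le> content v"
  shows "cand_hook lam v \<pi> \<in> factors lam \<pi>"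
proof -
  let ?q = "Q_path lam v \<pi>"
  note q = Q_path_facts[OF assms(1)]
  have "rim_hook lam (cand_hook lam v \<pi>) \<and> ne_tail (cand_hook lam v \<pi>) = ne_tail ?q
      \<and> path_length (cand_hook lam v \<pi>) = path_length ?q"
    using rim_hook_of_path[OF q(1) _ q(4)] q(2,6) assms(1) by (simp add: cand_iff)
  moreover have "sw_tail (rev ?q) = ne_tail ?q" "path_length (rev ?q) = path_length ?q"
    by (simp_all add: sw_tail_def ne_tail_def hd_rev path_length_def)
  moreover note args = assms Q_path[OF assms(1)]
  ultimately show ?thesis
    using sw_path_q[OF args] compatible_q[OF args] is_rpp_minus_q[OF args]
    unfolding factors_def by force
qed

end

theorem mainTheorem8:
  fixes lam :: "nat list" and \<pi> :: "cell \<Rightarrow> int" and u :: cell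
  assumes "is_partition lam"
    and "is_rpp lam \<pi>"
    and "u \<in> cand lam \<pi>"
  shows "\<exists>h \<in> factors lam \<pi>. rim_hook_le lam h (cand_hook lam u \<pi>)"
proof -
  interpret rpp lam \<pi> using assms by unfold_locales
  let ?X = "content ` cand lam \<pi>"
  have "cand lam \<pi> \<subseteq> D" by (auto simp: cand_iff)
  then have fin: "finite ?X" using finite_D by (blast intro: finite_subset)
  show ?thesis
  \<comment> \<open>Several candidates can share the maximal content. If \<open>u\<close> is one of
    them its own hook is taken, since \<open>rim_hook_le_cand_hook\<close> compares different
    candidates only for strictly different contents.\<close>
  proof (cases "content u = Max ?X")
    case True
    then have "cand_hook lam u \<pi> \<in> factors lam \<pi>"
      using assms(3) fin by (intro cand_hook_in_factors) auto
    then show ?thesis using rim_hook_le_cand_hook[OF assms(3,3)] by blast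
  next
    case False
    have "Max ?X \<in> ?X" using assms(3) fin by (intro Max_in) auto
    then obtain v where v: "v \<in> cand lam \<pi>" "Max ?X = content v" by auto
    then have max: "\<forall>w \<in> cand lam \<pi>. content w \<le> content v" using fin by (metis Max_ge imageI)
    then have "content u < content v" using False v assms(3) by fastforce
    then show ?thesis
      using cand_hook_in_factors[OF v(1) max] rim_hook_le_cand_hook[OF assms(3) v(1)] by blast
  qed
qed

end
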